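(* Let $W(A_7^{(2)})=\langle s_0,s_1,s_2,s_3,s_4\rangle$ be the Bäcklund transformation group of the $A_7^{(2)}$ system and $W(C_3^{(1)})=\langle S_0,S_1,S_2,S_3\rangle$ the Bäcklund transformation group of the $C_3^{(1)}$ system, both described in the context. For the change of parameters and variables $$\alpha_0=\frac{1}{\varepsilon}+A_0,\quad \alpha_1=-\frac{1}{\varepsilon},\quad \alpha_2=A_1,\quad \alpha_3=A_2,\quad \alpha_4=A_3,$$ $$t=\frac{T}{\varepsilon},\quad x=\varepsilon X,\quad y=\frac{Y}{\varepsilon},\quad z=\sqrt{\varepsilon}\,Z,\quad w=\frac{W}{\sqrt{\varepsilon}},$$ one can choose a subgroup $W_{A_7^{(2)}\to C_3^{(1)}}$ of $W(A_7^{(2)})$ such that $W_{A_7^{(2)}\to C_3^{(1)}}$ converges, as $\varepsilon\to0$, to the Bäcklund transformation group $W(C_3^{(1)})$ of the $C_3^{(1)}$ system.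
   Context: The $A_7^{(2)}$ system: $\frac{dx}{dt}=\frac{\partial H}{\partial y}$, $\frac{dy}{dt}=-\frac{\partial H}{\partial x}$, $\frac{dz}{dt}=\frac{\partial H}{\partial w}$, $\frac{dw}{dt}=-\frac{\partial H}{\partial z}$, with complex parameters satisfying $\alpha_0+\alpha_1+2\alpha_2+2\alpha_3+\alpha_4=1$ and $$\begin{aligned} t(t-1)H =\;&x^2y^3-((t+1)x+2\alpha_2+\alpha_3+\alpha_4)xy^2\\ &+\{tx^2+(\alpha_0+2\alpha_2+\alpha_3+\alpha_4-(\alpha_0+\alpha_1)t)x+\alpha_2(\alpha_2+\alpha_3+\alpha_4)\}y+\alpha_1 t x\\ &+\tfrac{1}{4}\big[-z^2w^4+2\alpha_4 zw^3+((2t-1)z^2-\alpha_4^2)w^2\\ &\qquad-2\{-\alpha_0-2\alpha_2-\alpha_3-\alpha_4+(\alpha_4+1)t\}zw-t(t-1)z^2\big]+y((y-1)x-\alpha_2)zw. \end{aligned}$$ Its Bäcklund transformation group $W(A_7^{(2)})$ is generated by, with $( * )=(x,y,z,w,t;\alpha_0,\dots,\alpha_4)$, $$\begin{aligned} s_0:( * ) \to &\left(x+\tfrac{\alpha_0}{y-1},y,z,w,t;-\alpha_0,\alpha_1,\alpha_2+\alpha_0,\alpha_3,\alpha_4 \right),\\ s_1:( * ) \to &\left(x+\tfrac{\alpha_1}{y},y,z,w,t;\alpha_0,-\alpha_1,\alpha_2+\alpha_1,\alpha_3,\alpha_4 \right),\\ s_2:( * ) \to &\left(x,y-\tfrac{\alpha_2}{x},z,w,t;\alpha_0+\alpha_2,\alpha_1+\alpha_2,-\alpha_2,\alpha_3+\alpha_2,\alpha_4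 \right),\\ s_3:( * ) \to &\left(x+\tfrac{\alpha_3}{y+w^2-t},y,z+\tfrac{2\alpha_3 w}{y+w^2-t},w,t;\alpha_0,\alpha_1,\alpha_2+\alpha_3,-\alpha_3,\alpha_4+2\alpha_3 \right),\\ s_4:( * ) \to &\left(x,y,z,w-\tfrac{\alpha_4}{z},t;\alpha_0,\alpha_1,\alpha_2,\alpha_3+\alpha_4,-\alpha_4 \right). \end{aligned}$$ The $C_3^{(1)}$ system, written in $X,Y,Z,W,T$ with complex parameters satisfying $A_0+2A_1+2A_2+A_3=1$: $\frac{dX}{dT}=\frac{\partial \tilde H}{\partial Y}$, $\frac{dY}{dT}=-\frac{\partial \tilde H}{\partial X}$, $\frac{dZ}{dT}=\frac{\partial \tilde H}{\partial W}$, $\frac{dW}{dT}=-\frac{\partial \tilde H}{\partial Z}$, with $$\begin{aligned} T^2\tilde H =\;&X^2Y^3-(TX+2A_1+A_2+A_3)XY^2-\{(A_0 T-1)X-A_1(A_1+A_2+A_3)\}Y-TX\\ &-\tfrac{Z^2W^4}{4}+\tfrac{A_3}{2}ZW^3+\tfrac{1}{4}(2TZ^2-A_3^2)W^2-\tfrac{1}{2}\{(A_3+1)T-1\}ZW-\tfrac{T^2 Z^2}{4}+(XY-A_1)YZW. \end{aligned}$$ Its Bäcklund transformation group $W(C_3^{(1)})$ is generated by, with $( * )=(X,Y,Z,W,T;A_0,A_1,A_2,A_3)$, $$\begin{aligned} S_0:( * ) \to &\left(-\left(X+\tfrac{A_0}{Y}+\tfrac{1}{Y^2} \right),-Y,\sqrt{-1}\,Z,\tfrac{W}{\sqrt{-1}},-T;-A_0,A_1+A_0,A_2,A_3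 \right),\\ S_1:( * ) \to &\left(X,Y-\tfrac{A_1}{X},Z,W,T;A_0+2A_1,-A_1,A_2+A_1,A_3 \right),\\ S_2:( * ) \to &\left(X+\tfrac{A_2}{Y+W^2-T},Y,Z+\tfrac{2A_2 W}{Y+W^2-T},W,T;A_0,A_1+A_2,-A_2,A_3+2A_2 \right),\\ S_3:( * ) \to &\left(X,Y,Z,W-\tfrac{A_3}{Z},T;A_0,A_1,A_2+A_3,-A_3 \right). \end{aligned}$$ Products of transformations are compositions of automorphisms of the function field. Through the change of variables, $\varepsilon=-1/\alpha_1$, $A_0=\alpha_0+\alpha_1$, $A_1=\alpha_2$, $A_2=\alpha_3$, $A_3=\alpha_4$, $T=\varepsilon t$, $X=x/\varepsilon$, $Y=\varepsilon y$, $Z=z/\sqrt\varepsilon$, $W=\sqrt\varepsilon\,w$, so an element of $W(A_7^{(2)})$ acts on $\varepsilon$ and on $X,Y,Z,W,T,A_0,\dots,A_3$; when it sends $\varepsilon$ to $-\varepsilon$, the branch $\sqrt{\varepsilon}\mapsto\sqrt{\varepsilon}/\sqrt{-1}$ is used. A subgroup of $W(A_7^{(2)})$ converges to $W(C_3^{(1)})$ if it is generated by elements whose actions on $X,Y,Z,W,T,A_0,A_1,A_2,A_3$ have limits as $\varepsilon\to0$ (with $X,Y,Z,W,T,A_i$ fixed) equal to the generators $S_0,S_1,S_2,S_3$. *)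

theory Defs
  imports
    "HOL-Analysis.Analysis"
    "HOL-Algebra.Generated_Groups"
    "HOL-Library.Poly_Mapping"
    "HOL-Computational_Algebra.Fraction_Field"
begin

section \<open>Rational function fields over the complex numbers\<close>

type_synonym 'v mpoly = "('v \<Rightarrow>\<^sub>0 nat) \<Rightarrow>\<^sub>0 complex"
type_synonym 'v ratfun = "'v mpoly fract"

definition const :: "complex \<Rightarrow> 'v::linorder ratfun" where
  "const c = Fract (Poly_Mapping.single 0 c) 1"

definition indet :: "'v::linorder \<Rightarrow> 'v ratfun" where
  "indet v = Fract (Poly_Mapping.single (Poly_Mapping.single v 1) 1) 1"

text \<open>Evaluation at a point \<open>\<sigma>\<close> with coordinates in a field \<open>'b\<close>, which is a complex
  algebra via \<open>\<kappa>\<close>. It is used for \<open>'b = complex\<close> (values of rational functions) and for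
  \<open>'b\<close> a function field (substitution). The \<open>THE\<close> below is determined whenever \<open>f\<close> is
  regular at \<open>\<sigma>\<close>; regularity means that some representing fraction has a denominator
  which does not vanish there.\<close>

definition poly_at :: "(complex \<Rightarrow> 'b::field) \<Rightarrow> ('v \<Rightarrow> 'b) \<Rightarrow> 'v::linorder mpoly \<Rightarrow> 'b" where
  "poly_at \<kappa> \<sigma> p =
    (\<Sum>m\<in>Poly_Mapping.keys p. \<kappa> (Poly_Mapping.lookup p m) *
       (\<Prod>v\<in>Poly_Mapping.keys m. \<sigma> v ^ Poly_Mapping.lookup m v))"

definition has_value :: "(complex \<Rightarrow> 'b::field) \<Rightarrow> ('v \<Rightarrow> 'b) \<Rightarrow> 'v::linorder ratfun \<Rightarrow> 'b \<Rightarrow> bool" where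
  "has_value \<kappa> \<sigma> f c \<longleftrightarrow>
    (\<exists>n d. f = Fract n d \<and> poly_at \<kappa> \<sigma> d \<noteq> 0 \<and> c = poly_at \<kappa> \<sigma> n / poly_at \<kappa> \<sigma> d)"

definition rat_at :: "(complex \<Rightarrow> 'b::field) \<Rightarrow> ('v \<Rightarrow> 'b) \<Rightarrow> 'v::linorder ratfun \<Rightarrow> 'b" where
  "rat_at \<kappa> \<sigma> f = (THE c. has_value \<kappa> \<sigma> f c)"

definition regular :: "('v \<Rightarrow> complex) \<Rightarrow> 'v::linorder ratfun \<Rightarrow> bool" where
  "regular p f \<longleftrightarrow> (\<exists>c. has_value id p f c)"

definition val :: "('v \<Rightarrow> complex) \<Rightarrow> 'v::linorder ratfun \<Rightarrow> complex" where
  "val p f = rat_at id p f"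

definition subst :: "('v \<Rightarrow> 'u ratfun) \<Rightarrow> 'v::linorder ratfun \<Rightarrow> 'u::linorder ratfun" where
  "subst \<sigma> f = rat_at const \<sigma> f"

definition field_aut :: "('v::linorder ratfun \<Rightarrow> 'v ratfun) monoid" where
  "field_aut =
    \<lparr>carrier = {\<phi>. bij \<phi> \<and> (\<forall>a b. \<phi> (a + b) = \<phi> a + \<phi> b) \<and> (\<forall>a b. \<phi> (a * b) = \<phi> a * \<phi> b)
                   \<and> (\<forall>c. \<phi> (const c) = const c)},
     monoid.mult = (\<circ>), one = id\<rparr>"


section \<open>The two function fields\<close>

text \<open>The parameters \<open>\<alpha>\<^sub>0\<close> and \<open>A\<^sub>0\<close> are eliminated by means of
  \<open>\<alpha>\<^sub>0 + \<alpha>\<^sub>1 + 2 \<alpha>\<^sub>2 + 2 \<alpha>\<^sub>3 + \<alpha>\<^sub>4 = 1\<close> and \<open>A\<^sub>0 + 2 A\<^sub>1 + 2 A\<^sub>2 + A\<^sub>3 = 1\<close>;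
  the remaining variables are algebraically independent. The linear orders carry no meaning;
  they are what the library requires for multivariate polynomials to form an integral domain.\<close>

datatype a7_var = Vx | Vy | Vz | Vw | Vt | Va1 | Va2 | Va3 | Va4

primrec a7_rank :: "a7_var \<Rightarrow> nat" where
  "a7_rank Vx = 0" | "a7_rank Vy = 1" | "a7_rank Vz = 2" | "a7_rank Vw = 3" | "a7_rank Vt = 4"
| "a7_rank Va1 = 5" | "a7_rank Va2 = 6" | "a7_rank Va3 = 7" | "a7_rank Va4 = 8"

instantiation a7_var :: linorder
begin
definition "u \<le> v \<longleftrightarrow> a7_rank u \<le> a7_rank v"
definition "u < v \<longleftrightarrow> a7_rank u < a7_rank v"
instance
proof
  fix u v :: a7_var
  assume "u \<le> v" "v \<le> u"
  then show "u = v" by (cases u; cases v) (simp_all add: less_eq_a7_var_def)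
qed (auto simp: less_eq_a7_var_def less_a7_var_def)
end

datatype c3_var = VX | VY | VZ | VW | VT | VA1 | VA2 | VA3

primrec c3_rank :: "c3_var \<Rightarrow> nat" where
  "c3_rank VX = 0" | "c3_rank VY = 1" | "c3_rank VZ = 2" | "c3_rank VW = 3" | "c3_rank VT = 4"
| "c3_rank VA1 = 5" | "c3_rank VA2 = 6" | "c3_rank VA3 = 7"

instantiation c3_var :: linorder
begin
definition "u \<le> v \<longleftrightarrow> c3_rank u \<le> c3_rank v"
definition "u < v \<longleftrightarrow> c3_rank u < c3_rank v"
instance
proof
  fix u v :: c3_var
  assume "u \<le> v" "v \<le> u"
  then show "u = v" by (cases u; cases v) (simp_all add: less_eq_c3_var_def)
qed (auto simp: less_eq_c3_var_def less_c3_var_def)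
end

abbreviation "rx \<equiv> indet Vx"
abbreviation "ry \<equiv> indet Vy"
abbreviation "rz \<equiv> indet Vz"
abbreviation "rw \<equiv> indet Vw"
abbreviation "rt \<equiv> indet Vt"
abbreviation "al1 \<equiv> indet Va1"
abbreviation "al2 \<equiv> indet Va2"
abbreviation "al3 \<equiv> indet Va3"
abbreviation "al4 \<equiv> indet Va4"

definition al0 :: "a7_var ratfun" where
  "al0 = 1 - al1 - 2 * al2 - 2 * al3 - al4"

abbreviation "RX \<equiv> indet VX"
abbreviation "RY \<equiv> indet VY"
abbreviation "RZ \<equiv> indet VZ"
abbreviation "RW \<equiv> indet VW"
abbreviation "RT \<equiv> indet VT"
abbreviation "A1 \<equiv> indet VA1"
abbreviation "A2 \<equiv> indet VA2"
abbreviation "A3 \<equiv> indet VA3"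

definition A0 :: "c3_var ratfun" where
  "A0 = 1 - 2 * A1 - 2 * A2 - A3"


section \<open>The Baecklund transformation groups\<close>

text \<open>Variables that are not updated are fixed. The images of \<open>\<alpha>\<^sub>0\<close> and \<open>A\<^sub>0\<close> are
  consequences, see the lemmas \<open>s_al0\<close> and \<open>S_A0\<close> below.\<close>

definition s0 :: "a7_var ratfun \<Rightarrow> a7_var ratfun" where
  "s0 = subst (indet(Vx := rx + al0 / (ry - 1), Va2 := al2 + al0))"

definition s1 :: "a7_var ratfun \<Rightarrow> a7_var ratfun" where
  "s1 = subst (indet(Vx := rx + al1 / ry, Va1 := - al1, Va2 := al2 + al1))"

definition s2 :: "a7_var ratfun \<Rightarrow> a7_var ratfun" where
  "s2 = subst (indet(Vy := ry - al2 / rx, Va1 := al1 + al2, Va2 := - al2, Va3 := al3 + al2))"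

definition s3 :: "a7_var ratfun \<Rightarrow> a7_var ratfun" where
  "s3 = subst (indet(Vx := rx + al3 / (ry + rw^2 - rt),
                     Vz := rz + 2 * al3 * rw / (ry + rw^2 - rt),
                     Va2 := al2 + al3, Va3 := - al3, Va4 := al4 + 2 * al3))"

definition s4 :: "a7_var ratfun \<Rightarrow> a7_var ratfun" where
  "s4 = subst (indet(Vw := rw - al4 / rz, Va3 := al3 + al4, Va4 := - al4))"

definition W_A7 :: "(a7_var ratfun \<Rightarrow> a7_var ratfun) set" where
  "W_A7 = generate field_aut {s0, s1, s2, s3, s4}"

definition S0 :: "c3_var ratfun \<Rightarrow> c3_var ratfun" where
  "S0 = subst (indet(VX := - (RX + A0 / RY + 1 / RY^2), VY := - RY,
                     VZ := const \<i> * RZ, VW := RW / const \<i>, VT := - RT, VA1 := A1 + A0))"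

definition S1 :: "c3_var ratfun \<Rightarrow> c3_var ratfun" where
  "S1 = subst (indet(VY := RY - A1 / RX, VA1 := - A1, VA2 := A2 + A1))"

definition S2 :: "c3_var ratfun \<Rightarrow> c3_var ratfun" where
  "S2 = subst (indet(VX := RX + A2 / (RY + RW^2 - RT),
                     VZ := RZ + 2 * A2 * RW / (RY + RW^2 - RT),
                     VA1 := A1 + A2, VA2 := - A2, VA3 := A3 + 2 * A2))"

definition S3 :: "c3_var ratfun \<Rightarrow> c3_var ratfun" where
  "S3 = subst (indet(VW := RW - A3 / RZ, VA2 := A2 + A3, VA3 := - A3))"

definition W_C3 :: "(c3_var ratfun \<Rightarrow> c3_var ratfun) set" where
  "W_C3 = generate field_aut {S0, S1, S2, S3}"


section \<open>Convergence as \<open>\<epsilon> \<longrightarrow> 0\<close>\<close>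

text \<open>The limit is taken along \<open>\<delta> = \<surd>\<epsilon> \<longrightarrow> 0\<close> in the punctured complex plane, so \<open>\<epsilon>\<close> is
  complex and both values of \<open>\<surd>\<epsilon>\<close> are covered.\<close>

primrec a7_point :: "complex \<Rightarrow> (c3_var \<Rightarrow> complex) \<Rightarrow> a7_var \<Rightarrow> complex" where
  "a7_point \<delta> P Vx = \<delta>\<^sup>2 * P VX"
| "a7_point \<delta> P Vy = P VY / \<delta>\<^sup>2"
| "a7_point \<delta> P Vz = \<delta> * P VZ"
| "a7_point \<delta> P Vw = P VW / \<delta>"
| "a7_point \<delta> P Vt = P VT / \<delta>\<^sup>2"
| "a7_point \<delta> P Va1 = - 1 / \<delta>\<^sup>2"
| "a7_point \<delta> P Va2 = P VA1"
| "a7_point \<delta> P Va3 = P VA2"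
| "a7_point \<delta> P Va4 = P VA3"

definition eps :: "a7_var ratfun" where
  "eps = - 1 / al1"

text \<open>The image of \<open>\<surd>\<epsilon>\<close> under \<open>g\<close>. Its square is \<open>g \<epsilon>\<close>. The branch is
  \<open>\<surd>\<epsilon> \<mapsto> \<surd>\<epsilon> / \<surd>(\<epsilon> / g \<epsilon>)\<close> with the principal square root in the denominator: this is
  \<open>\<surd>\<epsilon> / \<surd>(-1)\<close> if \<open>g \<epsilon> = - \<epsilon>\<close>, it is \<open>\<surd>\<epsilon>\<close> if \<open>g \<epsilon> = \<epsilon>\<close>, and it is asymptotic to
  \<open>\<surd>\<epsilon>\<close> if \<open>g \<epsilon>\<close> is asymptotic to \<open>\<epsilon>\<close>.\<close>

definition sqrt_eps_image ::
    "(a7_var ratfun \<Rightarrow> a7_var ratfun) \<Rightarrow> complex \<Rightarrow> (c3_var \<Rightarrow> complex) \<Rightarrow> complex" where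
  "sqrt_eps_image g \<delta> P = \<delta> / csqrt (\<delta>\<^sup>2 / val (a7_point \<delta> P) (g eps))"

text \<open>The image of \<open>f \<cdot> (\<surd>\<epsilon>)\<^sup>k\<close> under \<open>g\<close> has the limit \<open>h\<close>, at every point
  \<open>(X, Y, Z, W, T; A\<^sub>1, A\<^sub>2, A\<^sub>3)\<close> at which \<open>h\<close> is regular.\<close>

definition image_tendsto ::
    "(a7_var ratfun \<Rightarrow> a7_var ratfun) \<Rightarrow> a7_var ratfun \<Rightarrow> int \<Rightarrow> c3_var ratfun \<Rightarrow> bool" where
  "image_tendsto g f k h \<longleftrightarrow> (\<forall>P. regular P h \<longrightarrow>
     (\<forall>\<^sub>F \<delta> in at 0. regular (a7_point \<delta> P) (g f) \<and> regular (a7_point \<delta> P) (g eps)) \<and>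
     ((\<lambda>\<delta>. val (a7_point \<delta> P) (g f) * sqrt_eps_image g \<delta> P powi k) \<longlongrightarrow> val P h) (at 0))"

text \<open>The coordinates are \<open>X = x/\<epsilon>\<close>, \<open>Y = \<epsilon> y\<close>, \<open>Z = z/\<surd>\<epsilon>\<close>, \<open>W = \<surd>\<epsilon> w\<close>, \<open>T = \<epsilon> t\<close>,
  \<open>A\<^sub>0 = \<alpha>\<^sub>0 + \<alpha>\<^sub>1\<close>, \<open>A\<^sub>1 = \<alpha>\<^sub>2\<close>, \<open>A\<^sub>2 = \<alpha>\<^sub>3\<close>, \<open>A\<^sub>3 = \<alpha>\<^sub>4\<close>.\<close>

definition action_tendsto ::
    "(a7_var ratfun \<Rightarrow> a7_var ratfun) \<Rightarrow> (c3_var ratfun \<Rightarrow> c3_var ratfun) \<Rightarrow> bool" where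
  "action_tendsto g S \<longleftrightarrow>
     image_tendsto g rx (-2) (S RX) \<and>
     image_tendsto g ry 2 (S RY) \<and>
     image_tendsto g rz (-1) (S RZ) \<and>
     image_tendsto g rw 1 (S RW) \<and>
     image_tendsto g rt 2 (S RT) \<and>
     image_tendsto g (al0 + al1) 0 (S A0) \<and>
     image_tendsto g al2 0 (S A1) \<and>
     image_tendsto g al3 0 (S A2) \<and>
     image_tendsto g al4 0 (S A3)"

text \<open>Convergence of groups refers to the generators \<open>S\<^sub>0, \<dots>, S\<^sub>3\<close> of the limit group.\<close>

definition converges_to ::
    "(a7_var ratfun \<Rightarrow> a7_var ratfun) set \<Rightarrow> (c3_var ratfun \<Rightarrow> c3_var ratfun) set \<Rightarrow> bool" where
  "converges_to H G \<longleftrightarrow> (\<exists>g0 g1 g2 g3.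
     H = generate field_aut {g0, g1, g2, g3} \<and> G = generate field_aut {S0, S1, S2, S3} \<and>
     action_tendsto g0 S0 \<and> action_tendsto g1 S1 \<and>
     action_tendsto g2 S2 \<and> action_tendsto g3 S3)"


section \<open>The dependent parameters\<close>

lemma poly_at_superset:
  fixes p :: "'v::linorder mpoly"
  assumes "finite M" "Poly_Mapping.keys p \<subseteq> M" "\<kappa> 0 = 0"
  shows "poly_at \<kappa> \<sigma> p =
    (\<Sum>m\<in>M. \<kappa> (Poly_Mapping.lookup p m) *
       (\<Prod>v\<in>Poly_Mapping.keys m. \<sigma> v ^ Poly_Mapping.lookup m v))"
  unfolding poly_at_def using assms
  by (intro sum.mono_neutral_left) (auto simp: in_keys_iff)

locale complex_algebra =
  fixes \<kappa> :: "complex \<Rightarrow> 'b::field"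
  assumes hom_add: "\<kappa> (a + b) = \<kappa> a + \<kappa> b"
    and hom_mult: "\<kappa> (a * b) = \<kappa> a * \<kappa> b"
    and hom_one: "\<kappa> 1 = 1"
begin

lemma hom_zero [simp]: "\<kappa> 0 = 0"
  by (metis add_0 add_cancel_right_right hom_add)

lemma poly_at_add: "poly_at \<kappa> \<sigma> (p + q) = poly_at \<kappa> \<sigma> p + poly_at \<kappa> \<sigma> q"
proof -
  let ?M = "Poly_Mapping.keys p \<union> Poly_Mapping.keys q"
  have "Poly_Mapping.keys (p + q) \<subseteq> ?M" by (rule Poly_Mapping.keys_add)
  then show ?thesis
    by (simp add: poly_at_superset[of ?M] lookup_add hom_add distrib_right sum.distrib)
qed

lemma poly_at_single:
  "poly_at \<kappa> \<sigma> (Poly_Mapping.single m c) =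
     \<kappa> c * (\<Prod>v\<in>Poly_Mapping.keys m. \<sigma> v ^ Poly_Mapping.lookup m v)"
  by (simp add: poly_at_superset[of "{m}"])

lemma poly_at_zero [simp]: "poly_at \<kappa> \<sigma> 0 = 0"
  by (simp add: poly_at_def)

lemma poly_at_one [simp]: "poly_at \<kappa> \<sigma> 1 = 1"
  using poly_at_single[of \<sigma> 0 1] by (simp add: hom_one)

lemma poly_at_sum: "poly_at \<kappa> \<sigma> (sum f A) = (\<Sum>a\<in>A. poly_at \<kappa> \<sigma> (f a))"
  by (induction A rule: infinite_finite_induct) (simp_all add: poly_at_add)

lemma monomial_add:
  fixes \<sigma> :: "'v \<Rightarrow> 'b"
  shows "(\<Prod>v\<in>Poly_Mapping.keys (m + n). \<sigma> v ^ Poly_Mapping.lookup (m + n) v) =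
    (\<Prod>v\<in>Poly_Mapping.keys m. \<sigma> v ^ Poly_Mapping.lookup m v) *
    (\<Prod>v\<in>Poly_Mapping.keys n. \<sigma> v ^ Poly_Mapping.lookup n v)"
proof -
  let ?M = "Poly_Mapping.keys m \<union> Poly_Mapping.keys n"
  have sup: "(\<Prod>v\<in>Poly_Mapping.keys k. \<sigma> v ^ Poly_Mapping.lookup k v) =
      (\<Prod>v\<in>?M. \<sigma> v ^ Poly_Mapping.lookup k v)"
    if "Poly_Mapping.keys k \<subseteq> ?M" for k :: "'v \<Rightarrow>\<^sub>0 nat"
    using that by (intro prod.mono_neutral_left) (auto simp: in_keys_iff)
  show ?thesis
    unfolding sup[OF Poly_Mapping.keys_add] sup[OF Un_upper1] sup[OF Un_upper2]
    by (simp add: lookup_add power_add prod.distrib)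
qed

lemma poly_at_mult: "poly_at \<kappa> \<sigma> (p * q) = poly_at \<kappa> \<sigma> p * poly_at \<kappa> \<sigma> q"
proof -
  have expand: "r = (\<Sum>m\<in>Poly_Mapping.keys r. Poly_Mapping.single m (Poly_Mapping.lookup r m))"
    for r :: "'v mpoly"
    by (rule poly_mapping_eqI) (simp add: lookup_sum lookup_single when_def in_keys_iff)
  have "p * q = (\<Sum>m\<in>Poly_Mapping.keys p. \<Sum>n\<in>Poly_Mapping.keys q.
      Poly_Mapping.single (m + n) (Poly_Mapping.lookup p m * Poly_Mapping.lookup q n))"
    by (subst expand[of p], subst expand[of q]) (simp add: sum_product mult_single)
  then show ?thesis
    by (simp add: poly_at_sum poly_at_single hom_mult monomial_add sum_product poly_at_def[of \<kappa> \<sigma> p]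
        poly_at_def[of \<kappa> \<sigma> q] mult_ac)
qed

lemma has_value_unique:
  assumes "has_value \<kappa> \<sigma> f c" "has_value \<kappa> \<sigma> f c'"
  shows "c = c'"
proof -
  obtain n d n' d' where *: "f = Fract n d" "poly_at \<kappa> \<sigma> d \<noteq> 0" "c = poly_at \<kappa> \<sigma> n / poly_at \<kappa> \<sigma> d"
      "f = Fract n' d'" "poly_at \<kappa> \<sigma> d' \<noteq> 0" "c' = poly_at \<kappa> \<sigma> n' / poly_at \<kappa> \<sigma> d'"
    using assms unfolding has_value_def by blast
  then have "d \<noteq> 0" "d' \<noteq> 0" by auto
  with * have "n * d' = n' * d" by (simp add: eq_fract)
  then have "poly_at \<kappa> \<sigma> n * poly_at \<kappa> \<sigma> d' = poly_at \<kappa> \<sigma> n' * poly_at \<kappa> \<sigma> d"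
    by (metis poly_at_mult)
  then show ?thesis
    unfolding *(3,6) using *(2,5) by (simp add: frac_eq_eq)
qed

lemma has_value_rat_at: "has_value \<kappa> \<sigma> f c \<Longrightarrow> rat_at \<kappa> \<sigma> f = c"
  unfolding rat_at_def using has_value_unique by blast

lemma has_value_add:
  assumes "has_value \<kappa> \<sigma> f c" "has_value \<kappa> \<sigma> f' c'"
  shows "has_value \<kappa> \<sigma> (f + f') (c + c')"
proof -
  obtain n d n' d' where *: "f = Fract n d" "poly_at \<kappa> \<sigma> d \<noteq> 0" "c = poly_at \<kappa> \<sigma> n / poly_at \<kappa> \<sigma> d"
      "f' = Fract n' d'" "poly_at \<kappa> \<sigma> d' \<noteq> 0" "c' = poly_at \<kappa> \<sigma> n' / poly_at \<kappa> \<sigma> d'"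
    using assms unfolding has_value_def by blast
  from *(2,5) have "d \<noteq> 0" "d' \<noteq> 0" by auto
  have "f + f' = Fract (n * d' + n' * d) (d * d')"
    using \<open>d \<noteq> 0\<close> \<open>d' \<noteq> 0\<close> by (simp add: *(1,4))
  moreover have "c + c' = poly_at \<kappa> \<sigma> (n * d' + n' * d) / poly_at \<kappa> \<sigma> (d * d')"
    unfolding *(3,6) poly_at_mult poly_at_add using *(2,5) by (simp add: add_frac_eq)
  moreover have "poly_at \<kappa> \<sigma> (d * d') \<noteq> 0"
    using *(2,5) by (simp add: poly_at_mult)
  ultimately show ?thesis unfolding has_value_def by blast
qed

lemma has_value_mult:
  assumes "has_value \<kappa> \<sigma> f c" "has_value \<kappa> \<sigma> f' c'"
  shows "has_value \<kappa> \<sigma> (f * f') (c * c')"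
proof -
  obtain n d n' d' where *: "f = Fract n d" "poly_at \<kappa> \<sigma> d \<noteq> 0" "c = poly_at \<kappa> \<sigma> n / poly_at \<kappa> \<sigma> d"
      "f' = Fract n' d'" "poly_at \<kappa> \<sigma> d' \<noteq> 0" "c' = poly_at \<kappa> \<sigma> n' / poly_at \<kappa> \<sigma> d'"
    using assms unfolding has_value_def by blast
  then show ?thesis unfolding has_value_def
    by (intro exI[of _ "n * n'"] exI[of _ "d * d'"]) (simp add: poly_at_mult)
qed

lemma has_value_const: "has_value \<kappa> \<sigma> (const c) (\<kappa> c)"
  unfolding has_value_def const_def
  by (intro exI[of _ "Poly_Mapping.single 0 c"] exI[of _ 1]) (simp add: poly_at_single)

lemma has_value_indet: "has_value \<kappa> \<sigma> (indet v) (\<sigma> v)"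
  unfolding has_value_def indet_def
  by (intro exI[of _ "Poly_Mapping.single (Poly_Mapping.single v 1) 1"] exI[of _ 1])
     (simp add: poly_at_single hom_one)

lemma has_value_one: "has_value \<kappa> \<sigma> 1 1"
  using has_value_const[of \<sigma> 1] by (simp add: const_def hom_one One_fract_def)

lemma has_value_minus:
  fixes f :: "'v::linorder ratfun"
  assumes "has_value \<kappa> \<sigma> f c"
  shows "has_value \<kappa> \<sigma> (- f) (- c)"
proof -
  have "const (- 1) = (- 1 :: 'v ratfun)"
    by (simp add: const_def One_fract_def single_uminus)
  moreover have "\<kappa> (- 1) = - 1"
    using hom_add[of 1 "- 1"] by (simp add: hom_one eq_neg_iff_add_eq_0 add.commute)
  ultimately show ?thesis
    using has_value_mult[OF has_value_const[of \<sigma> "- 1"] assms] by simp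
qed

lemma has_value_diff:
  "has_value \<kappa> \<sigma> f c \<Longrightarrow> has_value \<kappa> \<sigma> f' c' \<Longrightarrow> has_value \<kappa> \<sigma> (f - f') (c - c')"
  using has_value_add[of \<sigma> f c "- f'" "- c'"] has_value_minus by force

lemma has_value_two: "has_value \<kappa> \<sigma> 2 2"
  using has_value_add[OF has_value_one has_value_one, of \<sigma>] by (simp only: one_add_one)

lemmas has_value_intros = has_value_one has_value_two has_value_indet has_value_const
  has_value_add has_value_mult has_value_minus has_value_diff

end

interpretation val: complex_algebra "id :: complex \<Rightarrow> complex"
  by standard simp_all

interpretation subst: complex_algebra "const :: complex \<Rightarrow> 'v::linorder ratfun"
  by standard (simp_all add: const_def One_fract_def single_add mult_single)

lemma subst_indet [simp]: "subst \<sigma> (indet v) = \<sigma> v"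
  unfolding subst_def by (rule subst.has_value_rat_at[OF subst.has_value_indet])

lemma subst_al0: "subst \<sigma> al0 = 1 - \<sigma> Va1 - 2 * \<sigma> Va2 - 2 * \<sigma> Va3 - \<sigma> Va4"
  unfolding subst_def al0_def
  by (rule subst.has_value_rat_at) (intro subst.has_value_intros)

lemma subst_A0: "subst \<sigma> A0 = 1 - 2 * \<sigma> VA1 - 2 * \<sigma> VA2 - \<sigma> VA3"
  unfolding subst_def A0_def
  by (rule subst.has_value_rat_at) (intro subst.has_value_intros)

lemma s_al0:
  "s0 al0 = - al0" "s1 al0 = al0" "s2 al0 = al0 + al2" "s3 al0 = al0" "s4 al0 = al0"
  by (simp_all add: s0_def s1_def s2_def s3_def s4_def subst_al0) (simp_all add: al0_def)

lemma S_A0: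
  "S0 A0 = - A0" "S1 A0 = A0 + 2 * A1" "S2 A0 = A0" "S3 A0 = A0"
  by (simp_all add: S0_def S1_def S2_def S3_def subst_A0) (simp_all add: A0_def)

lemma val_al0: "val (a7_point \<delta> P) al0 = 1 / \<delta>\<^sup>2 + val P A0"
proof -
  have "val (a7_point \<delta> P) al0 = 1 - (- 1 / \<delta>\<^sup>2) - 2 * P VA1 - 2 * P VA2 - P VA3"
    unfolding val_def al0_def
    by (rule val.has_value_rat_at)
       (use val.has_value_indet[of "a7_point \<delta> P"] a7_point.simps[of \<delta> P] in
         \<open>metis (no_types, lifting) val.has_value_intros(1,2,6,8)\<close>)
  moreover have "val P A0 = 1 - 2 * P VA1 - 2 * P VA2 - P VA3"
    unfolding val_def A0_def
    by (rule val.has_value_rat_at) (intro val.has_value_intros)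
  ultimately show ?thesis by simp
qed

end

theory Submission
  imports Defs
begin

text \<open>The subgroup is generated by \<open>s0 \<circ> s1\<close>, \<open>s2\<close>, \<open>s3\<close>, \<open>s4\<close>, whose limits are
  \<open>S0\<close>, \<open>S1\<close>, \<open>S2\<close>, \<open>S3\<close>. In the Dynkin diagram of type \<open>A\<^sub>7\<^sup>(\<^sup>2\<^sup>)\<close> the two nodes
  \<open>\<alpha>\<^sub>0\<close>, \<open>\<alpha>\<^sub>1\<close> at the fork, which tend to \<open>\<plusminus>\<infinity>\<close> while their sum stays \<open>A\<^sub>0\<close>, merge into
  the single end node of type \<open>C\<^sub>3\<^sup>(\<^sup>1\<^sup>)\<close>. Neither of their reflections has a limit, but
  the product changes the sign of both \<open>\<alpha>\<^sub>0\<close> and \<open>\<alpha>\<^sub>1\<close>; hence it sends \<open>\<epsilon>\<close> to \<open>- \<epsilon>\<close> and \<open>A\<^sub>0\<close>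
  to \<open>- A\<^sub>0\<close>, and the diverging parts of the two shifts of \<open>x\<close> cancel:
  \<open>\<epsilon>\<^sup>-\<^sup>1 (\<alpha>\<^sub>0 / (y - 1) + \<alpha>\<^sub>1 / y) = (1 + A\<^sub>0 Y) / (Y (Y - \<epsilon>))\<close>, which tends to
  \<open>A\<^sub>0 / Y + 1 / Y\<^sup>2\<close>. The reflections \<open>s3\<close> and \<open>s4\<close> fix \<open>\<epsilon>\<close> and are homogeneous for the
  scaling of the coordinates, so in the rescaled coordinates they do not depend on \<open>\<epsilon>\<close>;
  \<open>s2\<close> sends \<open>\<epsilon>\<close> to \<open>\<epsilon> / (1 - \<epsilon> A\<^sub>1)\<close>, which only contributes a factor tending to \<open>1\<close>.

  Two further points carry the proof. First, a group generated by the \<open>s\<^sub>i\<close> makes sense only if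
  the substitutions are defined on the whole function field and bijective. Each of them
  is an involution on the coordinates, and this forces both properties
  (\<open>involutive_subst.subst_in_field_aut\<close>). Second, convergence is required at every point where
  the image under \<open>S\<^sub>j\<close> is regular, so these points have to be shown to avoid the zeros of the
  visible denominators (\<open>irregular_if_pole_nearby\<close>).\<close>

section \<open>Evaluation of rational functions\<close>

context complex_algebra
begin

lemma has_value_cong: "has_value \<kappa> \<sigma> f c \<Longrightarrow> c = c' \<Longrightarrow> has_value \<kappa> \<sigma> f c'"
  by simp

lemma has_value_inverse:
  assumes "has_value \<kappa> \<sigma> f c" "c \<noteq> 0"
  shows "has_value \<kappa> \<sigma> (inverse f) (inverse c)"
proof -
  obtain n d where *: "f = Fract n d" "poly_at \<kappa> \<sigma> d \<noteq> 0" "c = poly_at \<kappa> \<sigma> n / poly_at \<kappa> \<sigma> d"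
    using assms unfolding has_value_def by blast
  then show ?thesis
    using assms(2) unfolding has_value_def
    by (intro exI[of _ d] exI[of _ n]) auto
qed

lemma has_value_divide:
  assumes "has_value \<kappa> \<sigma> f c" "has_value \<kappa> \<sigma> g d" "d \<noteq> 0"
  shows "has_value \<kappa> \<sigma> (f / g) (c / d)"
  using has_value_mult[OF assms(1) has_value_inverse[OF assms(2,3)]]
  by (simp add: divide_inverse)

lemma has_value_power: "has_value \<kappa> \<sigma> f c \<Longrightarrow> has_value \<kappa> \<sigma> (f ^ n) (c ^ n)"
  by (induction n) (simp_all add: has_value_one has_value_mult)

lemma has_value_zero: "has_value \<kappa> \<sigma> 0 0"
  using has_value_diff[OF has_value_one has_value_one] by simp

lemma has_value_sum:
  "(\<And>a. a \<in> A \<Longrightarrow> has_value \<kappa> \<sigma> (f a) (c a)) \<Longrightarrow> has_value \<kappa> \<sigma> (sum f A) (sum c A)"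
  by (induction A rule: infinite_finite_induct) (simp_all add: has_value_zero has_value_add)

lemma has_value_prod:
  "(\<And>a. a \<in> A \<Longrightarrow> has_value \<kappa> \<sigma> (f a) (c a)) \<Longrightarrow> has_value \<kappa> \<sigma> (prod f A) (prod c A)"
  by (induction A rule: infinite_finite_induct) (simp_all add: has_value_one has_value_mult)

lemma has_value_nonzero: "has_value \<kappa> \<sigma> f c \<Longrightarrow> c \<noteq> 0 \<Longrightarrow> f \<noteq> 0"
  using has_value_unique[OF _ has_value_zero] by blast

text \<open>Substitution followed by evaluation is evaluation at the values of the substituted
  functions. With \<open>\<kappa> = const\<close> this computes the composition of two substitutions.\<close>

lemma has_value_poly_at:
  assumes "\<And>v. has_value \<kappa> \<tau> (\<sigma> v) (\<rho> v)"
  shows "has_value \<kappa> \<tau> (poly_at const \<sigma> p) (poly_at \<kappa> \<rho> p)"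
  unfolding poly_at_def
  by (intro has_value_sum has_value_mult has_value_const has_value_prod has_value_power assms)

lemma has_value_al0:
  "has_value \<kappa> \<sigma> al0 (1 - \<sigma> Va1 - 2 * \<sigma> Va2 - 2 * \<sigma> Va3 - \<sigma> Va4)"
  unfolding al0_def by (intro has_value_intros)

lemma has_value_A0: "has_value \<kappa> \<sigma> A0 (1 - 2 * \<sigma> VA1 - 2 * \<sigma> VA2 - \<sigma> VA3)"
  unfolding A0_def by (intro has_value_intros)

text \<open>Applied as rules, these compute the value of an explicit rational function; what remains is
  that its denominators have nonzero values. Prefixing \<open>has_value_cong\<close> leaves also the
  comparison with the value in the goal.\<close>

lemmas value_intros = has_value_al0 has_value_A0 has_value_intros has_value_divide has_value_power

end

lemma val_eqI: "has_value id p f c \<Longrightarrow> val p f = c"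
  unfolding val_def by (rule val.has_value_rat_at)

lemma subst_eqI: "has_value const \<sigma> f c \<Longrightarrow> subst \<sigma> f = c"
  unfolding subst_def by (rule subst.has_value_rat_at)

section \<open>Involutive substitutions\<close>

lemma add_fract_one: "Fract (a + b) 1 = Fract a 1 + Fract b (1 :: 'a :: idom)"
  by simp

lemma Fract_sum: "Fract (sum f A) 1 = (\<Sum>a\<in>A. Fract (f a) (1 :: 'a :: idom))"
  by (induction A rule: infinite_finite_induct)
    (simp_all only: sum.insert sum.empty sum.infinite add_fract_one Zero_fract_def not_False_eq_True)

text \<open>Every polynomial is recovered from its coefficients by evaluating it at the
  indeterminates; the case of a monomial comes first.\<close>

lemma Fract_monomial:
  fixes m :: "'v::linorder \<Rightarrow>\<^sub>0 nat"
  shows "Fract (Poly_Mapping.single m c) 1 =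
    const c * (\<Prod>v\<in>Poly_Mapping.keys m. indet v ^ Poly_Mapping.lookup m v)"
proof -
  have power: "indet v ^ k = Fract (Poly_Mapping.single (Poly_Mapping.single v k) 1) 1" for v :: 'v and k
    by (induction k)
       (simp_all add: One_fract_def indet_def mult_single single_add[symmetric])
  have prod: "(\<Prod>v\<in>A. indet v ^ e v) =
      Fract (Poly_Mapping.single (\<Sum>v\<in>A. Poly_Mapping.single v (e v)) 1) 1"
    if "finite A" for A :: "'v set" and e
    using that by induction (simp_all add: One_fract_def power mult_single)
  have "m = (\<Sum>v\<in>Poly_Mapping.keys m. Poly_Mapping.single v (Poly_Mapping.lookup m v))"
    by (rule poly_mapping_eqI) (simp add: lookup_sum lookup_single when_def in_keys_iff)
  then show ?thesis
    by (simp add: prod const_def mult_single flip: One_fract_def)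
qed

lemma poly_at_indet: "poly_at const indet p = Fract p 1"
proof -
  have "p = (\<Sum>m\<in>Poly_Mapping.keys p. Poly_Mapping.single m (Poly_Mapping.lookup p m))"
    by (rule poly_mapping_eqI) (simp add: lookup_sum lookup_single when_def in_keys_iff)
  then have "Fract p 1 =
      (\<Sum>m\<in>Poly_Mapping.keys p. Fract (Poly_Mapping.single m (Poly_Mapping.lookup p m)) 1)"
    by (metis Fract_sum)
  then show ?thesis
    by (simp add: poly_at_def Fract_monomial)
qed

text \<open>The condition says that applying \<open>\<sigma>\<close> twice to a coordinate gives back the coordinate.
  It is phrased through \<open>has_value\<close> because \<open>subst \<sigma>\<close> is meaningful only where a value exists, which
  for general elements of the field is yet to be proved.\<close>

locale involutive_subst =
  fixes \<sigma> :: "'v::linorder \<Rightarrow> 'v ratfun"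
  assumes invol: "\<And>v. has_value const \<sigma> (\<sigma> v) (indet v)"
begin

lemma poly_at_invol: "has_value const \<sigma> (poly_at const \<sigma> p) (Fract p 1)"
  using subst.has_value_poly_at[where \<rho> = indet, OF invol] by (simp add: poly_at_indet)

text \<open>A second application of \<open>\<sigma>\<close> recovers \<open>p\<close> from its image, so the image cannot vanish. This is
  the algebraic independence of the functions \<open>\<sigma> v\<close>; it provides a nonzero denominator for the
  image of any fraction.\<close>

lemma poly_at_nonzero:
  assumes "p \<noteq> 0" shows "poly_at const \<sigma> p \<noteq> 0"
proof -
  have "Fract p 1 \<noteq> 0" using assms by (simp add: Zero_fract_def eq_fract)
  then show ?thesis using subst.has_value_nonzero[OF poly_at_invol] by blast
qed

lemma has_value_subst: "has_value const \<sigma> f (subst \<sigma> f)"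
proof (cases f)
  case (Fract n d)
  then have "has_value const \<sigma> f (poly_at const \<sigma> n / poly_at const \<sigma> d)"
    unfolding has_value_def using poly_at_nonzero by blast
  then show ?thesis unfolding subst_def by (simp add: subst.has_value_rat_at)
qed

lemma subst_subst: "subst \<sigma> (subst \<sigma> f) = f"
proof (cases f)
  case (Fract n d)
  have "subst \<sigma> f = poly_at const \<sigma> n / poly_at const \<sigma> d"
    using Fract poly_at_nonzero by (intro subst_eqI) (auto simp: has_value_def)
  moreover have "has_value const \<sigma> (poly_at const \<sigma> n / poly_at const \<sigma> d) (Fract n 1 / Fract d 1)"
    using Fract by (intro subst.has_value_divide poly_at_invol) (simp add: Zero_fract_def eq_fract)
  ultimately show ?thesis using Fract by (simp add: subst_eqI)
qed

lemma subst_in_field_aut: "subst \<sigma> \<in> carrier field_aut"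
proof -
  have "bij (subst \<sigma>)" by (rule o_bij[of "subst \<sigma>"]) (auto simp: subst_subst)
  then show ?thesis
    by (auto simp: field_aut_def intro!: subst_eqI subst.value_intros has_value_subst)
qed

end

lemma field_aut_group: "group field_aut"
proof (rule groupI)
  fix \<phi> :: "'a ratfun \<Rightarrow> 'a ratfun"
  assume "\<phi> \<in> carrier field_aut"
  then have *: "bij \<phi>" "\<And>a b. \<phi> (a + b) = \<phi> a + \<phi> b" "\<And>a b. \<phi> (a * b) = \<phi> a * \<phi> b"
    "\<And>c. \<phi> (const c) = const c" by (auto simp: field_aut_def)
  have inv: "inv_into UNIV \<phi> a = b" if "\<phi> b = a" for a b
    using that *(1) by (auto simp: bij_def)
  have inv': "\<phi> (inv_into UNIV \<phi> a) = a" for a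
    using *(1) by (simp add: bij_is_surj surj_f_inv_f)
  have "inv_into UNIV \<phi> \<in> carrier field_aut"
    using * by (auto simp: field_aut_def bij_imp_bij_inv inv' intro!: inv)
  moreover have "inv_into UNIV \<phi> \<circ> \<phi> = id"
    using *(1) by (simp add: bij_is_inj)
  ultimately show "\<exists>\<psi>\<in>carrier field_aut. \<psi> \<otimes>\<^bsub>field_aut\<^esub> \<phi> = \<one>\<^bsub>field_aut\<^esub>"
    by (auto simp: field_aut_def)
qed (auto simp: field_aut_def bij_comp)

section \<open>The generators are automorphisms\<close>

lemma indet_nonzero [simp]: "indet v \<noteq> 0"
proof -
  have "has_value id (\<lambda>_. 1) (indet v) 1" by (rule val.has_value_indet)
  then show ?thesis by (rule val.has_value_nonzero) simp
qed

text \<open>A rational function is nonzero as soon as it has a nonzero value at one point. This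
  provides the denominators of the transformations.\<close>

lemma y_neq_1: "ry \<noteq> 1"
proof -
  have "has_value id (\<lambda>_. 0) (ry - 1) (0 - 1)" by (intro val.value_intros)
  then have "ry - 1 \<noteq> 0" by (rule val.has_value_nonzero) simp
  then show ?thesis by simp
qed

lemma s3_denominator_nonzero: "ry + rw\<^sup>2 \<noteq> rt"
proof -
  have "has_value id (indicator {Vy}) (ry + rw\<^sup>2 - rt)
      (indicator {Vy} Vy + (indicator {Vy} Vw)\<^sup>2 - indicator {Vy} Vt)"
    by (intro val.value_intros)
  then have "ry + rw\<^sup>2 - rt \<noteq> 0" by (rule val.has_value_nonzero) simp
  then show ?thesis by simp
qed

lemma S2_denominator_nonzero: "RY + RW\<^sup>2 \<noteq> RT"
proof -
  have "has_value id (indicator {VY}) (RY + RW\<^sup>2 - RT)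
      (indicator {VY} VY + (indicator {VY} VW)\<^sup>2 - indicator {VY} VT)"
    by (intro val.value_intros)
  then have "RY + RW\<^sup>2 - RT \<noteq> 0" by (rule val.has_value_nonzero) simp
  then show ?thesis by simp
qed

lemma al1_plus_al2_nonzero: "al1 + al2 \<noteq> 0"
proof -
  have "has_value id (\<lambda>_. 1) (al1 + al2) (1 + 1)" by (intro val.value_intros)
  then show ?thesis by (rule val.has_value_nonzero) simp
qed

lemma s0_automorphism: "s0 \<in> carrier field_aut"
  unfolding s0_def
proof (intro involutive_subst.subst_in_field_aut involutive_subst.intro)
  fix v
  \<comment> \<open>The left-hand side is the value of \<open>al0\<close> at the substituted coordinates.\<close>
  have al0: "1 - al1 - 2 * (al2 + al0) - 2 * al3 - al4 = - al0"
    by (simp add: al0_def)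
  let ?\<sigma> = "indet(Vx := rx + al0 / (ry - 1), Va2 := al2 + al0)"
  show "has_value const ?\<sigma> (?\<sigma> v) (indet v)"
    by (cases v; (simp only: fun_upd_apply a7_var.distinct if_False if_True simp_thms)?;
        rule subst.has_value_cong,
        (rule subst.value_intros
          | (simp only: fun_upd_apply a7_var.distinct if_False if_True simp_thms al0;
              simp add: y_neq_1; fail)
          | (simp; fail))+)
qed

lemma s1_automorphism: "s1 \<in> carrier field_aut"
  unfolding s1_def
proof (intro involutive_subst.subst_in_field_aut involutive_subst.intro)
  fix v
  let ?\<sigma> = "indet(Vx := rx + al1 / ry, Va1 := - al1, Va2 := al2 + al1)"
  show "has_value const ?\<sigma> (?\<sigma> v) (indet v)"
    by (cases v; (simp only: fun_upd_apply a7_var.distinct if_False if_True simp_thms)?;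
        rule subst.has_value_cong, (rule subst.value_intros | (simp; fail))+)
qed

lemma s2_automorphism: "s2 \<in> carrier field_aut"
  unfolding s2_def
proof (intro involutive_subst.subst_in_field_aut involutive_subst.intro)
  fix v
  let ?\<sigma> = "indet(Vy := ry - al2 / rx, Va1 := al1 + al2, Va2 := - al2, Va3 := al3 + al2)"
  show "has_value const ?\<sigma> (?\<sigma> v) (indet v)"
    by (cases v; (simp only: fun_upd_apply a7_var.distinct if_False if_True simp_thms)?;
        rule subst.has_value_cong, (rule subst.value_intros | (simp; fail))+)
qed

lemma s3_automorphism: "s3 \<in> carrier field_aut"
  unfolding s3_def
proof (intro involutive_subst.subst_in_field_aut involutive_subst.intro)
  fix v
  let ?\<sigma> = "indet(Vx := rx + al3 / (ry + rw\<^sup>2 - rt),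
                     Vz := rz + 2 * al3 * rw / (ry + rw\<^sup>2 - rt),
                     Va2 := al2 + al3, Va3 := - al3, Va4 := al4 + 2 * al3)"
  show "has_value const ?\<sigma> (?\<sigma> v) (indet v)"
    by (cases v; (simp only: fun_upd_apply a7_var.distinct if_False if_True simp_thms)?;
        rule subst.has_value_cong, (rule subst.value_intros | (simp add: s3_denominator_nonzero; fail))+)
qed

lemma s4_automorphism: "s4 \<in> carrier field_aut"
  unfolding s4_def
proof (intro involutive_subst.subst_in_field_aut involutive_subst.intro)
  fix v
  let ?\<sigma> = "indet(Vw := rw - al4 / rz, Va3 := al3 + al4, Va4 := - al4)"
  show "has_value const ?\<sigma> (?\<sigma> v) (indet v)"
    by (cases v; (simp only: fun_upd_apply a7_var.distinct if_False if_True simp_thms)?;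
        rule subst.has_value_cong, (rule subst.value_intros | (simp; fail))+)
qed

section \<open>Poles of the limit transformations\<close>

lemma tendsto_poly_at:
  assumes "\<And>v. ((\<lambda>s. Q s v) \<longlongrightarrow> P v) F"
  shows "((\<lambda>s. poly_at id (Q s) d) \<longlongrightarrow> poly_at id P d) F"
  unfolding poly_at_def by (intro tendsto_intros assms)

text \<open>A numerator and a denominator may vanish together at \<open>P\<close>, so a zero of the denominator
  does not by itself exclude a value there. The set of regular points, however, is open, and along
  a curve \<open>Q\<close> of zeros of \<open>D\<close> ending at \<open>P\<close> a regular \<open>h\<close> would give \<open>h * D\<close> the value \<open>0\<close>.
  It therefore suffices that \<open>h * D\<close> is nonzero on the curve away from its end.\<close>

lemma irregular_if_pole_nearby:
  fixes P :: "'v::linorder \<Rightarrow> complex"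
  assumes near: "\<And>v. ((\<lambda>s. Q s v) \<longlongrightarrow> P v) (at (0 :: complex))"
    and D: "\<And>s. has_value id (Q s) D 0"
    and N: "\<And>s. has_value id (Q s) (h * D) (N s)" "\<forall>\<^sub>F s in at 0. N s \<noteq> 0"
  shows "\<not> regular P h"
proof
  assume "regular P h"
  then obtain n d where h: "h = Fract n d" and d: "poly_at id P d \<noteq> 0"
    unfolding regular_def has_value_def by blast
  have "\<forall>\<^sub>F s in at 0. poly_at id (Q s) d \<noteq> 0"
    by (rule tendsto_imp_eventually_ne[OF tendsto_poly_at[OF near] d])
  with N(2) have "\<forall>\<^sub>F s in at (0 :: complex). False"
  proof eventually_elim
    case (elim s)
    then have "has_value id (Q s) h (poly_at id (Q s) n / poly_at id (Q s) d)"
      unfolding has_value_def using h by blast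
    from val.has_value_mult[OF this D] N(1) have "N s = 0"
      using val.has_value_unique by fastforce
    with elim show False by simp
  qed
  then show False by simp
qed

lemma tendsto_fun_upd:
  assumes "\<And>w. ((\<lambda>s. Q s w) \<longlongrightarrow> P w) F" "(q \<longlongrightarrow> P u) F"
  shows "((\<lambda>s. ((Q s)(u := q s)) v) \<longlongrightarrow> P v) F"
  using assms by (cases "v = u") auto

lemma eventually_shift_nonzero: "\<forall>\<^sub>F s in at 0. a + s \<noteq> (0 :: complex)"
  using eventually_neq_at_within[of "- a"]
  by eventually_elim (metis add_eq_0_iff2 add.commute)

lemma tendsto_shift: "((\<lambda>s. a + s) \<longlongrightarrow> a) (at (0 :: complex))"
  by (auto intro!: tendsto_eq_intros)

text \<open>In this case the numerator is \<open>- 1\<close> on the zero set of the denominator, and the constant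
  curve suffices.\<close>

lemma regular_S0_X:
  assumes "regular P (S0 RX)" shows "P VY \<noteq> 0"
proof
  assume Y: "P VY = 0"
  have *: "- (RX + A0 / RY + 1 / RY\<^sup>2) * RY\<^sup>2 = - (RX * RY\<^sup>2 + A0 * RY + 1)"
    by (simp add: field_simps power2_eq_square)
  have "\<not> regular P (- (RX + A0 / RY + 1 / RY\<^sup>2))"
  proof (rule irregular_if_pole_nearby)
    show "has_value id P (RY\<^sup>2) 0"
      by (rule val.has_value_cong, (rule val.value_intros | (simp add: Y; fail))+)
    show "has_value id P (- (RX + A0 / RY + 1 / RY\<^sup>2) * RY\<^sup>2) (- 1)"
      unfolding * by (rule val.has_value_cong, (rule val.value_intros | (simp add: Y; fail))+)
  qed auto
  with assms show False by (simp add: S0_def)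
qed

text \<open>The numerator is \<open>- A1\<close> where \<open>X\<close> vanishes, and \<open>A1\<close> can be moved away from \<open>0\<close>
  independently of \<open>X\<close>. The same device applies to the remaining denominators.\<close>

lemma regular_S1_Y:
  assumes "regular P (S1 RY)" shows "P VX \<noteq> 0"
proof
  assume X: "P VX = 0"
  have *: "(RY - A1 / RX) * RX = RY * RX - A1"
    by (simp add: field_simps)
  have "\<not> regular P (RY - A1 / RX)"
  proof (rule irregular_if_pole_nearby)
    let ?Q = "\<lambda>s. P(VA1 := P VA1 + s)"
    show "((\<lambda>s. ?Q s v) \<longlongrightarrow> P v) (at 0)" for v
      by (intro tendsto_fun_upd tendsto_shift tendsto_const)
    show "has_value id (?Q s) RX 0" for s
      by (rule val.has_value_cong, (rule val.value_intros | (simp add: X; fail))+)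
    show "has_value id (?Q s) ((RY - A1 / RX) * RX) (- (P VA1 + s))" for s
      unfolding * by (rule val.has_value_cong, (rule val.value_intros | (simp add: X; fail))+)
    show "\<forall>\<^sub>F s in at 0. - (P VA1 + s) \<noteq> 0"
      using eventually_shift_nonzero[of "P VA1"] by eventually_elim (metis neg_equal_0_iff_equal)
  qed
  with assms show False by (simp add: S1_def)
qed

lemma regular_S2_X:
  assumes "regular P (S2 RX)" shows "P VY + (P VW)\<^sup>2 - P VT \<noteq> 0"
proof
  assume D: "P VY + (P VW)\<^sup>2 - P VT = 0"
  let ?D = "RY + RW\<^sup>2 - RT"
  have *: "(RX + A2 / ?D) * ?D = RX * ?D + A2"
    using S2_denominator_nonzero by (simp add: distrib_right)
  have "\<not> regular P (RX + A2 / ?D)"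
  proof (rule irregular_if_pole_nearby)
    let ?Q = "\<lambda>s. P(VA2 := P VA2 + s)"
    show "((\<lambda>s. ?Q s v) \<longlongrightarrow> P v) (at 0)" for v
      by (intro tendsto_fun_upd tendsto_shift tendsto_const)
    show "has_value id (?Q s) ?D 0" for s
      by (rule val.has_value_cong, (rule val.value_intros | (simp add: D; fail))+)
    show "has_value id (?Q s) ((RX + A2 / ?D) * ?D) (P VA2 + s)" for s
      unfolding * by (rule val.has_value_cong, (rule val.value_intros | (simp add: D; fail))+)
    show "\<forall>\<^sub>F s in at 0. P VA2 + s \<noteq> 0"
      by (rule eventually_shift_nonzero)
  qed
  with assms show False by (simp add: S2_def)
qed

text \<open>The numerator \<open>2 A\<^sub>2 W\<close> may vanish through either factor, so both are moved; \<open>T\<close> is adjusted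
  to stay on the zero set of \<open>Y + W\<^sup>2 - T\<close>.\<close>

lemma regular_S2_Z:
  assumes "regular P (S2 RZ)" shows "P VY + (P VW)\<^sup>2 - P VT \<noteq> 0"
proof
  assume D: "P VY + (P VW)\<^sup>2 - P VT = 0"
  let ?D = "RY + RW\<^sup>2 - RT"
  have *: "(RZ + 2 * A2 * RW / ?D) * ?D = RZ * ?D + 2 * A2 * RW"
    using S2_denominator_nonzero by (simp add: distrib_right)
  have "\<not> regular P (RZ + 2 * A2 * RW / ?D)"
  proof (rule irregular_if_pole_nearby)
    let ?Q = "\<lambda>s. P(VA2 := P VA2 + s, VW := P VW + s, VT := P VY + (P VW + s)\<^sup>2)"
    have "((\<lambda>s. P VY + (P VW + s)\<^sup>2) \<longlongrightarrow> P VY + (P VW)\<^sup>2) (at 0)"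
      by (intro tendsto_intros tendsto_shift)
    moreover have "P VY + (P VW)\<^sup>2 = P VT" using D by simp
    ultimately show "((\<lambda>s. ?Q s v) \<longlongrightarrow> P v) (at 0)" for v
      by (intro tendsto_fun_upd tendsto_shift tendsto_const) simp
    show "has_value id (?Q s) ?D 0" for s
      by (rule val.has_value_cong, (rule val.value_intros | (simp; fail))+)
    show "has_value id (?Q s) ((RZ + 2 * A2 * RW / ?D) * ?D) (2 * (P VA2 + s) * (P VW + s))" for s
      unfolding * by (rule val.has_value_cong, (rule val.value_intros | (simp; fail))+)
    show "\<forall>\<^sub>F s in at 0. 2 * (P VA2 + s) * (P VW + s) \<noteq> 0"
      using eventually_shift_nonzero[of "P VA2"] eventually_shift_nonzero[of "P VW"]
      by eventually_elim (metis mult_eq_0_iff zero_neq_numeral)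
  qed
  with assms show False by (simp add: S2_def)
qed

lemma regular_S3_W:
  assumes "regular P (S3 RW)" shows "P VZ \<noteq> 0"
proof
  assume Z: "P VZ = 0"
  have *: "(RW - A3 / RZ) * RZ = RW * RZ - A3"
    by (simp add: field_simps)
  have "\<not> regular P (RW - A3 / RZ)"
  proof (rule irregular_if_pole_nearby)
    let ?Q = "\<lambda>s. P(VA3 := P VA3 + s)"
    show "((\<lambda>s. ?Q s v) \<longlongrightarrow> P v) (at 0)" for v
      by (intro tendsto_fun_upd tendsto_shift tendsto_const)
    show "has_value id (?Q s) RZ 0" for s
      by (rule val.has_value_cong, (rule val.value_intros | (simp add: Z; fail))+)
    show "has_value id (?Q s) ((RW - A3 / RZ) * RZ) (- (P VA3 + s))" for s
      unfolding * by (rule val.has_value_cong, (rule val.value_intros | (simp add: Z; fail))+)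
    show "\<forall>\<^sub>F s in at 0. - (P VA3 + s) \<noteq> 0"
      using eventually_shift_nonzero[of "P VA3"] by eventually_elim (metis neg_equal_0_iff_equal)
  qed
  with assms show False by (simp add: S3_def)
qed

section \<open>Limits of the images of the coordinates\<close>

text \<open>The limit \<open>c\<close> of the quotient of \<open>\<surd>\<epsilon>\<close> by its image under \<open>g\<close>, where \<open>r\<close> is \<open>\<epsilon> / g \<epsilon>\<close>.\<close>

definition sqrt_eps_ratio :: "(a7_var ratfun \<Rightarrow> a7_var ratfun) \<Rightarrow> complex \<Rightarrow> bool" where
  "sqrt_eps_ratio g c \<longleftrightarrow> c \<noteq> 0 \<and> (\<forall>P. \<exists>r.
     (\<forall>\<^sub>F \<delta> in at 0. has_value id (a7_point \<delta> P) (g eps) (\<delta>\<^sup>2 / r \<delta>)) \<and>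
     ((\<lambda>\<delta>. csqrt (r \<delta>)) \<longlongrightarrow> c) (at 0))"

text \<open>The branch \<open>g (\<surd>\<epsilon>)\<close> differs from \<open>\<delta>\<close> by a factor tending to \<open>1 / c\<close>, so it can be replaced
  by \<open>\<delta>\<close> at the price of dividing the limit by \<open>c\<close> to the power \<open>k\<close>.\<close>

lemma image_tendstoI:
  assumes ratio: "sqrt_eps_ratio g c"
    and val: "\<And>P. regular P h \<Longrightarrow> \<forall>\<^sub>F \<delta> in at 0. has_value id (a7_point \<delta> P) (g f) (V P \<delta>)"
    and lim: "\<And>P. regular P h \<Longrightarrow> ((\<lambda>\<delta>. V P \<delta> * \<delta> powi k) \<longlongrightarrow> L P) (at 0)"
    and limit: "\<And>P. regular P h \<Longrightarrow> has_value id P h (L P / c powi k)"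
  shows "image_tendsto g f k h"
  unfolding image_tendsto_def
proof (intro allI impI conjI)
  fix P assume P: "regular P h"
  obtain r where c: "c \<noteq> 0"
    and r: "\<forall>\<^sub>F \<delta> in at 0. has_value id (a7_point \<delta> P) (g eps) (\<delta>\<^sup>2 / r \<delta>)"
    and r_lim: "((\<lambda>\<delta>. csqrt (r \<delta>)) \<longlongrightarrow> c) (at 0)"
    using ratio unfolding sqrt_eps_ratio_def by blast
  show "\<forall>\<^sub>F \<delta> in at 0. regular (a7_point \<delta> P) (g f) \<and> regular (a7_point \<delta> P) (g eps)"
    using r val[OF P] by eventually_elim (auto simp: regular_def)
  have "((\<lambda>\<delta>. (V P \<delta> * \<delta> powi k) / csqrt (r \<delta>) powi k) \<longlongrightarrow> L P / c powi k) (at 0)"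
    using c by (intro tendsto_divide lim[OF P] tendsto_power_int r_lim) (auto simp: power_int_eq_0_iff)
  moreover have "\<forall>\<^sub>F \<delta> in at 0. (V P \<delta> * \<delta> powi k) / csqrt (r \<delta>) powi k =
      val (a7_point \<delta> P) (g f) * sqrt_eps_image g \<delta> P powi k"
    using r val[OF P] eventually_neq_at_within[of 0]
  proof eventually_elim
    case (elim \<delta>)
    then show ?case
      by (simp add: val_eqI[OF elim(1)] val_eqI[OF elim(2)] sqrt_eps_image_def power_int_divide_distrib)
  qed
  ultimately show "((\<lambda>\<delta>. val (a7_point \<delta> P) (g f) * sqrt_eps_image g \<delta> P powi k) \<longlongrightarrow> val P h) (at 0)"
    unfolding val_eqI[OF limit[OF P]] by (rule Lim_transform_eventually)
qed

text \<open>If the image of \<open>f\<close> scales with a power of \<open>\<delta>\<close>, the rescaled image depends on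
  \<open>\<delta>\<close> only through the branch of the root. This covers all coordinates
  except the image of \<open>x\<close> under \<open>s0 \<circ> s1\<close>.\<close>

lemma image_tendsto_homogeneous:
  assumes "sqrt_eps_ratio g c"
    and val: "\<And>P \<delta>. regular P h \<Longrightarrow> \<delta> \<noteq> 0 \<Longrightarrow> has_value id (a7_point \<delta> P) (g f) (L P / \<delta> powi k)"
    and "\<And>P. regular P h \<Longrightarrow> has_value id P h (L P / c powi k)"
  shows "image_tendsto g f k h"
proof (rule image_tendstoI[OF assms(1) _ _ assms(3)])
  fix P assume P: "regular P h"
  show "\<forall>\<^sub>F \<delta> in at 0. has_value id (a7_point \<delta> P) (g f) (L P / \<delta> powi k)"
    using eventually_neq_at_within[of 0] by eventually_elim (rule val[OF P])
  have "\<forall>\<^sub>F \<delta> in at 0. L P = L P / \<delta> powi k * \<delta> powi k"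
    using eventually_neq_at_within[of 0] by eventually_elim (simp add: power_int_eq_0_iff)
  then show "((\<lambda>\<delta>. L P / \<delta> powi k * \<delta> powi k) \<longlongrightarrow> L P) (at 0)"
    by (rule Lim_transform_eventually[OF tendsto_const])
qed

lemma sqrt_eps_ratio_fixed:
  assumes "g eps = eps"
  shows "sqrt_eps_ratio g 1"
proof -
  have "has_value id (a7_point \<delta> P) (g eps) (\<delta>\<^sup>2 / 1)" if "\<delta> \<noteq> 0" for P \<delta>
    unfolding assms unfolding eps_def
    by (rule val.has_value_cong, (rule val.value_intros | (simp add: that; fail))+)
  then have "\<forall>\<^sub>F \<delta> in at 0. has_value id (a7_point \<delta> P) (g eps) (\<delta>\<^sup>2 / 1)" for P
    using eventually_neq_at_within[of 0] by (rule eventually_mono[rotated])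
  then show ?thesis
    unfolding sqrt_eps_ratio_def by (intro conjI allI exI[of _ "\<lambda>_. 1"]) simp_all
qed

section \<open>The limit of \<open>s0 \<circ> s1\<close>\<close>

lemma s1_images:
  "s1 rx = rx + al1 / ry" "s1 ry = ry" "s1 rz = rz" "s1 rw = rw" "s1 rt = rt"
  "s1 (al0 + al1) = al0 - al1" "s1 al2 = al2 + al1" "s1 al3 = al3" "s1 al4 = al4"
  "s1 eps = 1 / al1"
  unfolding s1_def eps_def
  by (rule subst_eqI, rule subst.has_value_cong,
      (rule subst.value_intros | (simp add: al0_def; fail))+)+

lemma s0_s1_images:
  "(s0 \<circ> s1) rx = rx + al0 / (ry - 1) + al1 / ry"
  "(s0 \<circ> s1) ry = ry" "(s0 \<circ> s1) rz = rz" "(s0 \<circ> s1) rw = rw" "(s0 \<circ> s1) rt = rt"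
  "(s0 \<circ> s1) (al0 + al1) = - al0 - al1" "(s0 \<circ> s1) al2 = al2 + al0 + al1"
  "(s0 \<circ> s1) al3 = al3" "(s0 \<circ> s1) al4 = al4" "(s0 \<circ> s1) eps = 1 / al1"
  unfolding o_apply s1_images s0_def
  by (rule subst_eqI, rule subst.has_value_cong,
      (rule subst.value_intros | (simp add: al0_def; fail))+)+

lemma S0_images:
  "S0 RX = - (RX + A0 / RY + 1 / RY\<^sup>2)" "S0 RY = - RY" "S0 RZ = const \<i> * RZ"
  "S0 RW = RW / const \<i>" "S0 RT = - RT" "S0 A1 = A1 + A0" "S0 A2 = A2" "S0 A3 = A3"
  unfolding S0_def by simp_all

text \<open>Here \<open>\<epsilon>\<close> changes its sign, and the value \<open>c = \<i>\<close> of \<open>\<surd>(-1)\<close> produces the factors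
  \<open>\<i>\<close> and \<open>1 / \<i>\<close> of \<open>Z\<close> and \<open>W\<close> in \<open>S0\<close>.\<close>

lemma sqrt_eps_ratio_s0_s1: "sqrt_eps_ratio (s0 \<circ> s1) \<i>"
proof -
  have "has_value id (a7_point \<delta> P) ((s0 \<circ> s1) eps) (\<delta>\<^sup>2 / - 1)" if "\<delta> \<noteq> 0" for P \<delta>
    unfolding s0_s1_images
    by (rule val.has_value_cong, (rule val.value_intros | (simp add: that; fail))+)
  then have "\<forall>\<^sub>F \<delta> in at 0. has_value id (a7_point \<delta> P) ((s0 \<circ> s1) eps) (\<delta>\<^sup>2 / - 1)" for P
    using eventually_neq_at_within[of 0] by (rule eventually_mono[rotated])
  then show ?thesis
    unfolding sqrt_eps_ratio_def by (intro conjI allI exI[of _ "\<lambda>_. - 1"]) simp_all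
qed

text \<open>The one computation that is not a rescaling concerns \<open>x\<close>: its two shifts are brought
  over a common denominator, where the factor \<open>\<delta>\<^sup>2\<close> splits off.\<close>

lemma s0_s1_tendsto_S0: "action_tendsto (s0 \<circ> s1) S0"
proof -
  note homogeneous = image_tendsto_homogeneous[OF sqrt_eps_ratio_s0_s1]
  have "image_tendsto (s0 \<circ> s1) rx (- 2) (S0 RX)"
  proof (rule image_tendstoI[OF sqrt_eps_ratio_s0_s1])
    fix P assume "regular P (S0 RX)"
    then have Y: "P VY \<noteq> 0" by (rule regular_S0_X)
    let ?A0 = "1 - 2 * P VA1 - 2 * P VA2 - P VA3"
    let ?V = "\<lambda>P \<delta>. \<delta>\<^sup>2 * (P VX
        + (1 + (1 - 2 * P VA1 - 2 * P VA2 - P VA3) * P VY) / (P VY * (P VY - \<delta>\<^sup>2)))"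
    have lim: "((\<lambda>\<delta>. P VY - \<delta>\<^sup>2) \<longlongrightarrow> P VY) (at 0)"
      by (auto intro!: tendsto_eq_intros)
    have "\<forall>\<^sub>F \<delta> in at 0. P VY - \<delta>\<^sup>2 \<noteq> 0"
      by (rule tendsto_imp_eventually_ne[OF lim Y])
    then show "\<forall>\<^sub>F \<delta> in at 0. has_value id (a7_point \<delta> P) ((s0 \<circ> s1) rx) (?V P \<delta>)"
      using eventually_neq_at_within[of 0]
    proof eventually_elim
      case (elim \<delta>)
      then have *: "P VY / \<delta>\<^sup>2 - 1 = (P VY - \<delta>\<^sup>2) / \<delta>\<^sup>2" "P VY \<noteq> \<delta>\<^sup>2"
        by (simp_all add: diff_divide_distrib)
      have shifts: "\<delta>\<^sup>2 * P VX + (1 + 1 / \<delta>\<^sup>2 - 2 * P VA1 - 2 * P VA2 - P VA3) / ((P VY - \<delta>\<^sup>2) / \<delta>\<^sup>2)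
          - 1 / P VY = ?V P \<delta>"
        using Y elim by (simp add: divide_simps) (simp add: algebra_simps)
      show ?case
        unfolding s0_s1_images
        by (rule val.has_value_cong, (rule val.value_intros
            | (use Y elim shifts in \<open>simp add: *\<close>; fail))+)
    qed
    \<comment> \<open>The poles of order \<open>\<delta>\<^sup>-\<^sup>2\<close> have cancelled, so the limit is found by setting \<open>\<delta> = 0\<close>.\<close>
    have "((\<lambda>\<delta>. P VX + (1 + ?A0 * P VY) / (P VY * (P VY - \<delta>\<^sup>2)))
        \<longlongrightarrow> P VX + (1 + ?A0 * P VY) / (P VY * P VY)) (at 0)"
      using Y by (intro tendsto_intros lim) simp
    moreover have "\<forall>\<^sub>F \<delta> in at 0. P VX + (1 + ?A0 * P VY) / (P VY * (P VY - \<delta>\<^sup>2)) = ?V P \<delta> * \<delta> powi - 2"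
      using eventually_neq_at_within[of 0] by eventually_elim (simp add: power_int_minus)
    ultimately show "((\<lambda>\<delta>. ?V P \<delta> * \<delta> powi - 2) \<longlongrightarrow>
        P VX + (1 + (1 - 2 * P VA1 - 2 * P VA2 - P VA3) * P VY) / (P VY * P VY)) (at 0)"
      by (rule Lim_transform_eventually)
    show "has_value id P (S0 RX)
        ((P VX + (1 + (1 - 2 * P VA1 - 2 * P VA2 - P VA3) * P VY) / (P VY * P VY)) / \<i> powi - 2)"
      unfolding S0_images
      by (rule val.has_value_cong, (rule val.value_intros
          | (use Y in \<open>simp add: power_int_minus field_simps power2_eq_square\<close>; fail))+)
  qed
  moreover have "image_tendsto (s0 \<circ> s1) ry 2 (S0 RY)"
    by (rule homogeneous[where L = "\<lambda>P. P VY"]; unfold s0_s1_images S0_images;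
        rule val.has_value_cong, (rule val.value_intros | (simp; fail))+)
  moreover have "image_tendsto (s0 \<circ> s1) rz (- 1) (S0 RZ)"
    by (rule homogeneous[where L = "\<lambda>P. P VZ"]; unfold s0_s1_images S0_images;
        rule val.has_value_cong,
        (rule val.value_intros
          | (simp add: power_int_minus divide_inverse mult.commute; fail))+)
  moreover have "image_tendsto (s0 \<circ> s1) rw 1 (S0 RW)"
    by (rule homogeneous[where L = "\<lambda>P. P VW"]; unfold s0_s1_images S0_images;
        rule val.has_value_cong, (rule val.value_intros | (simp; fail))+)
  moreover have "image_tendsto (s0 \<circ> s1) rt 2 (S0 RT)"
    by (rule homogeneous[where L = "\<lambda>P. P VT"]; unfold s0_s1_images S0_images;
        rule val.has_value_cong, (rule val.value_intros | (simp; fail))+)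
  moreover have "image_tendsto (s0 \<circ> s1) (al0 + al1) 0 (S0 A0)"
    by (rule homogeneous[where L = "\<lambda>P. - (1 - 2 * P VA1 - 2 * P VA2 - P VA3)"];
        unfold s0_s1_images S_A0;
        rule val.has_value_cong, (rule val.value_intros | (simp; fail))+)
  moreover have "image_tendsto (s0 \<circ> s1) al2 0 (S0 A1)"
    by (rule homogeneous[where L = "\<lambda>P. P VA1 + (1 - 2 * P VA1 - 2 * P VA2 - P VA3)"];
        unfold s0_s1_images S0_images;
        rule val.has_value_cong, (rule val.value_intros | (simp; fail))+)
  moreover have "image_tendsto (s0 \<circ> s1) al3 0 (S0 A2)"
    by (rule homogeneous[where L = "\<lambda>P. P VA2"]; unfold s0_s1_images S0_images;
        rule val.has_value_cong, (rule val.value_intros | (simp; fail))+)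
  moreover have "image_tendsto (s0 \<circ> s1) al4 0 (S0 A3)"
    by (rule homogeneous[where L = "\<lambda>P. P VA3"]; unfold s0_s1_images S0_images;
        rule val.has_value_cong, (rule val.value_intros | (simp; fail))+)
  ultimately show ?thesis
    unfolding action_tendsto_def by blast
qed

section \<open>The limit of \<open>s2\<close>\<close>

lemma s2_images:
  "s2 rx = rx" "s2 ry = ry - al2 / rx" "s2 rz = rz" "s2 rw = rw" "s2 rt = rt"
  "s2 (al0 + al1) = al0 + al1 + 2 * al2" "s2 al2 = - al2" "s2 al3 = al3 + al2" "s2 al4 = al4"
  "s2 eps = - 1 / (al1 + al2)"
  unfolding s2_def eps_def
  by (rule subst_eqI, rule subst.has_value_cong,
      (rule subst.value_intros | (simp add: al0_def al1_plus_al2_nonzero; fail))+)+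

lemma S1_images:
  "S1 RX = RX" "S1 RY = RY - A1 / RX" "S1 RZ = RZ" "S1 RW = RW" "S1 RT = RT"
  "S1 A1 = - A1" "S1 A2 = A2 + A1" "S1 A3 = A3"
  unfolding S1_def by simp_all

text \<open>The factor \<open>1 / (1 - \<epsilon> A\<^sub>1)\<close> by which \<open>s2\<close> changes \<open>\<epsilon>\<close> is not constant,
  so the continuity of the square root at \<open>1\<close> enters.\<close>

lemma sqrt_eps_ratio_s2: "sqrt_eps_ratio s2 1"
proof -
  have lim: "((\<lambda>\<delta>. 1 - \<delta>\<^sup>2 * a) \<longlongrightarrow> 1) (at 0)" for a :: complex
    by (auto intro!: tendsto_eq_intros)
  have "\<forall>\<^sub>F \<delta> in at 0. has_value id (a7_point \<delta> P) (s2 eps) (\<delta>\<^sup>2 / (1 - \<delta>\<^sup>2 * P VA1))" for P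
    using tendsto_imp_eventually_ne[OF lim[of "P VA1"] one_neq_zero] eventually_neq_at_within[of 0]
  proof eventually_elim
    case (elim \<delta>)
    then have *: "- 1 / \<delta>\<^sup>2 + P VA1 = - (1 - \<delta>\<^sup>2 * P VA1) / \<delta>\<^sup>2"
      by (simp add: field_simps)
    have "has_value id (a7_point \<delta> P) (al1 + al2) (- (1 - \<delta>\<^sup>2 * P VA1) / \<delta>\<^sup>2)"
      unfolding *[symmetric]
      by (rule val.has_value_cong, (rule val.value_intros | (simp; fail))+)
    from val.has_value_divide[OF val.has_value_minus[OF val.has_value_one] this]
    have "has_value id (a7_point \<delta> P) (s2 eps) (- 1 / (- (1 - \<delta>\<^sup>2 * P VA1) / \<delta>\<^sup>2))"
      unfolding s2_images using elim by simp
    then show ?case by (rule val.has_value_cong) (use elim in \<open>simp add: field_simps\<close>)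
  qed
  moreover have "((\<lambda>\<delta>. csqrt (1 - \<delta>\<^sup>2 * a)) \<longlongrightarrow> csqrt 1) (at 0)" for a
    by (rule isCont_tendsto_compose[OF continuous_at_csqrt lim]) simp
  ultimately show ?thesis
    unfolding sqrt_eps_ratio_def by (auto intro!: exI)
qed

lemma s2_tendsto_S1: "action_tendsto s2 S1"
proof -
  note homogeneous = image_tendsto_homogeneous[OF sqrt_eps_ratio_s2]
  have "image_tendsto s2 rx (- 2) (S1 RX)"
    by (rule homogeneous[where L = "\<lambda>P. P VX"]; unfold s2_images S1_images;
        rule val.has_value_cong,
        (rule val.value_intros
          | (simp add: power_int_minus divide_inverse mult.commute; fail))+)
  moreover have "image_tendsto s2 ry 2 (S1 RY)"
  proof (rule homogeneous[where L = "\<lambda>P. P VY - P VA1 / P VX"])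
    fix P assume "regular P (S1 RY)"
    then have X: "P VX \<noteq> 0" by (rule regular_S1_Y)
    show "has_value id (a7_point \<delta> P) (s2 ry) ((P VY - P VA1 / P VX) / \<delta> powi 2)" if "\<delta> \<noteq> 0" for \<delta>
      unfolding s2_images
      by (rule val.has_value_cong,
          (rule val.value_intros | (simp add: X that power_int_minus field_simps power2_eq_square; fail))+)
    show "has_value id P (S1 RY) ((P VY - P VA1 / P VX) / 1 powi 2)"
      unfolding S1_images
      by (rule val.has_value_cong, (rule val.value_intros | (use X in simp; fail))+)
  qed
  moreover have "image_tendsto s2 rz (- 1) (S1 RZ)"
    by (rule homogeneous[where L = "\<lambda>P. P VZ"]; unfold s2_images S1_images;
        rule val.has_value_cong,
        (rule val.value_intros
          | (simp add: power_int_minus divide_inverse mult.commute; fail))+)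
  moreover have "image_tendsto s2 rw 1 (S1 RW)"
    by (rule homogeneous[where L = "\<lambda>P. P VW"]; unfold s2_images S1_images;
        rule val.has_value_cong, (rule val.value_intros | (simp; fail))+)
  moreover have "image_tendsto s2 rt 2 (S1 RT)"
    by (rule homogeneous[where L = "\<lambda>P. P VT"]; unfold s2_images S1_images;
        rule val.has_value_cong, (rule val.value_intros | (simp; fail))+)
  moreover have "image_tendsto s2 (al0 + al1) 0 (S1 A0)"
    by (rule homogeneous[where L = "\<lambda>P. 1 - 2 * P VA2 - P VA3"]; unfold s2_images S_A0;
        rule val.has_value_cong, (rule val.value_intros | (simp; fail))+)
  moreover have "image_tendsto s2 al2 0 (S1 A1)"
    by (rule homogeneous[where L = "\<lambda>P. - P VA1"]; unfold s2_images S1_images;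
        rule val.has_value_cong, (rule val.value_intros | (simp; fail))+)
  moreover have "image_tendsto s2 al3 0 (S1 A2)"
    by (rule homogeneous[where L = "\<lambda>P. P VA2 + P VA1"]; unfold s2_images S1_images;
        rule val.has_value_cong, (rule val.value_intros | (simp; fail))+)
  moreover have "image_tendsto s2 al4 0 (S1 A3)"
    by (rule homogeneous[where L = "\<lambda>P. P VA3"]; unfold s2_images S1_images;
        rule val.has_value_cong, (rule val.value_intros | (simp; fail))+)
  ultimately show ?thesis
    unfolding action_tendsto_def by blast
qed

section \<open>The limits of \<open>s3\<close> and \<open>s4\<close>\<close>

lemma s3_images:
  "s3 rx = rx + al3 / (ry + rw\<^sup>2 - rt)" "s3 ry = ry"
  "s3 rz = rz + 2 * al3 * rw / (ry + rw\<^sup>2 - rt)" "s3 rw = rw" "s3 rt = rt"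
  "s3 (al0 + al1) = al0 + al1" "s3 al2 = al2 + al3" "s3 al3 = - al3" "s3 al4 = al4 + 2 * al3"
  "s3 eps = eps"
  unfolding s3_def eps_def
  by (rule subst_eqI, rule subst.has_value_cong,
      (rule subst.value_intros | (simp add: al0_def s3_denominator_nonzero; fail))+)+

lemma s3_denominator_rescaled:
  fixes \<delta> :: complex
  shows "P VY / \<delta>\<^sup>2 + (P VW / \<delta>)\<^sup>2 - P VT / \<delta>\<^sup>2 = (P VY + (P VW)\<^sup>2 - P VT) / \<delta>\<^sup>2"
  by (simp add: power_divide add_divide_distrib diff_divide_distrib)

lemma S2_images:
  "S2 RX = RX + A2 / (RY + RW\<^sup>2 - RT)" "S2 RY = RY"
  "S2 RZ = RZ + 2 * A2 * RW / (RY + RW\<^sup>2 - RT)" "S2 RW = RW" "S2 RT = RT"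
  "S2 A1 = A1 + A2" "S2 A2 = - A2" "S2 A3 = A3 + 2 * A2"
  unfolding S2_def by simp_all

lemma s3_tendsto_S2: "action_tendsto s3 S2"
proof -
  note homogeneous = image_tendsto_homogeneous[OF sqrt_eps_ratio_fixed[of s3, OF s3_images(10)]]
  have "image_tendsto s3 rx (- 2) (S2 RX)"
  proof (rule homogeneous[where L = "\<lambda>P. P VX + P VA2 / (P VY + (P VW)\<^sup>2 - P VT)"])
    fix P assume "regular P (S2 RX)"
    then have D: "P VY + (P VW)\<^sup>2 - P VT \<noteq> 0" by (rule regular_S2_X)
    show "has_value id (a7_point \<delta> P) (s3 rx) ((P VX + P VA2 / (P VY + (P VW)\<^sup>2 - P VT)) / \<delta> powi - 2)"
      if "\<delta> \<noteq> 0" for \<delta>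
      unfolding s3_images
      by (rule val.has_value_cong, (rule val.value_intros
        | (simp only: a7_point.simps s3_denominator_rescaled;
          use D that in \<open>simp add: power_int_minus field_simps power2_eq_square\<close>; fail))+)
    show "has_value id P (S2 RX) ((P VX + P VA2 / (P VY + (P VW)\<^sup>2 - P VT)) / 1 powi - 2)"
      unfolding S2_images
      by (rule val.has_value_cong, (rule val.value_intros | (use D in simp; fail))+)
  qed
  moreover have "image_tendsto s3 ry 2 (S2 RY)"
    by (rule homogeneous[where L = "\<lambda>P. P VY"]; unfold s3_images S2_images;
        rule val.has_value_cong, (rule val.value_intros | (simp; fail))+)
  moreover have "image_tendsto s3 rz (- 1) (S2 RZ)"
  proof (rule homogeneous[where L = "\<lambda>P. P VZ + 2 * P VA2 * P VW / (P VY + (P VW)\<^sup>2 - P VT)"])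
    fix P assume "regular P (S2 RZ)"
    then have D: "P VY + (P VW)\<^sup>2 - P VT \<noteq> 0" by (rule regular_S2_Z)
    show "has_value id (a7_point \<delta> P) (s3 rz) ((P VZ + 2 * P VA2 * P VW / (P VY + (P VW)\<^sup>2 - P VT)) / \<delta> powi - 1)"
      if "\<delta> \<noteq> 0" for \<delta>
      unfolding s3_images
      by (rule val.has_value_cong, (rule val.value_intros
        | (simp only: a7_point.simps s3_denominator_rescaled;
          use D that in \<open>simp add: power_int_minus field_simps power2_eq_square\<close>; fail))+)
    show "has_value id P (S2 RZ) ((P VZ + 2 * P VA2 * P VW / (P VY + (P VW)\<^sup>2 - P VT)) / 1 powi - 1)"
      unfolding S2_images
      by (rule val.has_value_cong, (rule val.value_intros | (use D in simp; fail))+)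
  qed
  moreover have "image_tendsto s3 rw 1 (S2 RW)"
    by (rule homogeneous[where L = "\<lambda>P. P VW"]; unfold s3_images S2_images;
        rule val.has_value_cong, (rule val.value_intros | (simp; fail))+)
  moreover have "image_tendsto s3 rt 2 (S2 RT)"
    by (rule homogeneous[where L = "\<lambda>P. P VT"]; unfold s3_images S2_images;
        rule val.has_value_cong, (rule val.value_intros | (simp; fail))+)
  moreover have "image_tendsto s3 (al0 + al1) 0 (S2 A0)"
    by (rule homogeneous[where L = "\<lambda>P. 1 - 2 * P VA1 - 2 * P VA2 - P VA3"];
        unfold s3_images S_A0;
        rule val.has_value_cong, (rule val.value_intros | (simp; fail))+)
  moreover have "image_tendsto s3 al2 0 (S2 A1)"
    by (rule homogeneous[where L = "\<lambda>P. P VA1 + P VA2"]; unfold s3_images S2_images;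
        rule val.has_value_cong, (rule val.value_intros | (simp; fail))+)
  moreover have "image_tendsto s3 al3 0 (S2 A2)"
    by (rule homogeneous[where L = "\<lambda>P. - P VA2"]; unfold s3_images S2_images;
        rule val.has_value_cong, (rule val.value_intros | (simp; fail))+)
  moreover have "image_tendsto s3 al4 0 (S2 A3)"
    by (rule homogeneous[where L = "\<lambda>P. P VA3 + 2 * P VA2"]; unfold s3_images S2_images;
        rule val.has_value_cong, (rule val.value_intros | (simp; fail))+)
  ultimately show ?thesis
    unfolding action_tendsto_def by blast
qed

lemma s4_images:
  "s4 rx = rx" "s4 ry = ry" "s4 rz = rz" "s4 rw = rw - al4 / rz" "s4 rt = rt"
  "s4 (al0 + al1) = al0 + al1" "s4 al2 = al2" "s4 al3 = al3 + al4" "s4 al4 = - al4"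
  "s4 eps = eps"
  unfolding s4_def eps_def
  by (rule subst_eqI, rule subst.has_value_cong,
      (rule subst.value_intros | (simp add: al0_def; fail))+)+

lemma S3_images:
  "S3 RX = RX" "S3 RY = RY" "S3 RZ = RZ" "S3 RW = RW - A3 / RZ" "S3 RT = RT"
  "S3 A1 = A1" "S3 A2 = A2 + A3" "S3 A3 = - A3"
  unfolding S3_def by simp_all

lemma s4_tendsto_S3: "action_tendsto s4 S3"
proof -
  note homogeneous = image_tendsto_homogeneous[OF sqrt_eps_ratio_fixed[of s4, OF s4_images(10)]]
  have "image_tendsto s4 rx (- 2) (S3 RX)"
    by (rule homogeneous[where L = "\<lambda>P. P VX"]; unfold s4_images S3_images;
        rule val.has_value_cong,
        (rule val.value_intros
          | (simp add: power_int_minus divide_inverse mult.commute; fail))+)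
  moreover have "image_tendsto s4 ry 2 (S3 RY)"
    by (rule homogeneous[where L = "\<lambda>P. P VY"]; unfold s4_images S3_images;
        rule val.has_value_cong, (rule val.value_intros | (simp; fail))+)
  moreover have "image_tendsto s4 rz (- 1) (S3 RZ)"
    by (rule homogeneous[where L = "\<lambda>P. P VZ"]; unfold s4_images S3_images;
        rule val.has_value_cong,
        (rule val.value_intros
          | (simp add: power_int_minus divide_inverse mult.commute; fail))+)
  moreover have "image_tendsto s4 rw 1 (S3 RW)"
  proof (rule homogeneous[where L = "\<lambda>P. P VW - P VA3 / P VZ"])
    fix P assume "regular P (S3 RW)"
    then have Z: "P VZ \<noteq> 0" by (rule regular_S3_W)
    show "has_value id (a7_point \<delta> P) (s4 rw) ((P VW - P VA3 / P VZ) / \<delta> powi 1)" if "\<delta> \<noteq> 0" for \<delta>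
      unfolding s4_images
      by (rule val.has_value_cong,
          (rule val.value_intros | (simp add: Z that power_int_minus field_simps power2_eq_square; fail))+)
    show "has_value id P (S3 RW) ((P VW - P VA3 / P VZ) / 1 powi 1)"
      unfolding S3_images
      by (rule val.has_value_cong, (rule val.value_intros | (use Z in simp; fail))+)
  qed
  moreover have "image_tendsto s4 rt 2 (S3 RT)"
    by (rule homogeneous[where L = "\<lambda>P. P VT"]; unfold s4_images S3_images;
        rule val.has_value_cong, (rule val.value_intros | (simp; fail))+)
  moreover have "image_tendsto s4 (al0 + al1) 0 (S3 A0)"
    by (rule homogeneous[where L = "\<lambda>P. 1 - 2 * P VA1 - 2 * P VA2 - P VA3"];
        unfold s4_images S_A0;
        rule val.has_value_cong, (rule val.value_intros | (simp; fail))+)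
  moreover have "image_tendsto s4 al2 0 (S3 A1)"
    by (rule homogeneous[where L = "\<lambda>P. P VA1"]; unfold s4_images S3_images;
        rule val.has_value_cong, (rule val.value_intros | (simp; fail))+)
  moreover have "image_tendsto s4 al3 0 (S3 A2)"
    by (rule homogeneous[where L = "\<lambda>P. P VA2 + P VA3"]; unfold s4_images S3_images;
        rule val.has_value_cong, (rule val.value_intros | (simp; fail))+)
  moreover have "image_tendsto s4 al4 0 (S3 A3)"
    by (rule homogeneous[where L = "\<lambda>P. - P VA3"]; unfold s4_images S3_images;
        rule val.has_value_cong, (rule val.value_intros | (simp; fail))+)
  ultimately show ?thesis
    unfolding action_tendsto_def by blast
qed

section \<open>The convergent subgroup\<close>

theorem theorem3p3:
  shows "\<exists>H. subgroup H (field_aut\<lparr>carrier := W_A7\<rparr>) \<and> converges_to H W_C3"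
proof (intro exI conjI)
  let ?H = "generate field_aut {s0 \<circ> s1, s2, s3, s4}"
  interpret group "field_aut :: (a7_var ratfun \<Rightarrow> a7_var ratfun) monoid"
    by (rule field_aut_group)
  have gens: "{s0, s1, s2, s3, s4} \<subseteq> carrier field_aut"
    using s0_automorphism s1_automorphism s2_automorphism s3_automorphism s4_automorphism by simp
  then have W: "subgroup W_A7 field_aut"
    unfolding W_A7_def by (rule generate_is_subgroup)
  have mem: "s0 \<in> W_A7" "s1 \<in> W_A7" "s2 \<in> W_A7" "s3 \<in> W_A7" "s4 \<in> W_A7"
    unfolding W_A7_def by (auto intro: generate.incl)
  have "s0 \<circ> s1 \<in> W_A7"
    using subgroup.m_closed[OF W mem(1,2)] by (simp add: field_aut_def)
  with mem have H: "{s0 \<circ> s1, s2, s3, s4} \<subseteq> W_A7" by simp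
  show "subgroup ?H (field_aut\<lparr>carrier := W_A7\<rparr>)"
  proof (rule subgroup_incl[OF _ W])
    show "subgroup ?H field_aut"
      using H subgroup.subset[OF W] by (intro generate_is_subgroup) (rule subset_trans)
    show "?H \<subseteq> W_A7"
      using generate_subgroup_incl[OF H W] .
  qed
  show "converges_to ?H W_C3"
    unfolding converges_to_def W_C3_def
    using s0_s1_tendsto_S0 s2_tendsto_S1 s3_tendsto_S2 s4_tendsto_S3 by blast
qed

end
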